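(* For all finite subsets $A$ of $\mathbb{Z}_{>0}$, the chromatic polynomial of $\Gamma_A$ is $$\mathrm{ch}_{\Gamma_A}(t)=\sum_{k=1}^{|A|}s_D(A,k)\,t^k,$$ where $(-1)^{k}s_D(A,k)$ is equal to the number of D-permutations on $A$ with exactly $k$ cycles.
   Context: For a finite set $A\subset\mathbb{Z}_{>0}$, $\Gamma_A$ is the bipartite graph on vertex set $A$ with an edge $\{u,v\}$ for each $u<v$ in $A$ with $u$ odd and $v$ even. A permutation $\sigma$ of $A$ is a D-permutation on $A$ if $i\le\sigma(i)$ whenever $i\in A$ is odd and $i\ge\sigma(i)$ whenever $i\in A$ is even. Fixed points count as cycles.
   Formalization: The sign is corrected: (-1)^(|A|-k) s_D(A,k), not (-1)^k s_D(A,k), is the number of D-permutations with k cycles (for A={1} the printed sign gives -t instead of t); and A is assumed nonempty, since for empty A the sum is 0 but the chromatic polynomial is 1. *)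

theory Defs
  imports
    "HOL-Computational_Algebra.Polynomial"
    "HOL-Combinatorics.Combinatorics"
    "HOL-Library.FuncSet"
begin

text \<open>A simple graph is given by its vertex set and its set of edges, each edge a two-element
  set of vertices.\<close>

definition Gamma_edges :: "nat set \<Rightarrow> nat set set" where
  "Gamma_edges A = {{u, v} | u v. u \<in> A \<and> v \<in> A \<and> u < v \<and> odd u \<and> even v}"

definition proper_colorings :: "'a set \<Rightarrow> 'a set set \<Rightarrow> nat \<Rightarrow> ('a \<Rightarrow> nat) set" where
  "proper_colorings V E n =
     {c \<in> V \<rightarrow>\<^sub>E {..<n}. \<forall>u v. {u, v} \<in> E \<longrightarrow> c u \<noteq> c v}"

definition chromatic_polynomial :: "'a set \<Rightarrow> 'a set set \<Rightarrow> int poly" where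
  "chromatic_polynomial V E =
     (THE p. \<forall>n::nat. poly p (int n) = int (card (proper_colorings V E n)))"

text \<open>A polynomial is determined by its values at the natural numbers, so the description above
  is satisfied by at most one polynomial.\<close>

lemma chromatic_polynomial_eqI:
  assumes "\<And>n::nat. poly p (int n) = int (card (proper_colorings V E n))"
  shows "chromatic_polynomial V E = p"
  unfolding chromatic_polynomial_def
proof (rule the_equality)
  show "\<forall>n::nat. poly p (int n) = int (card (proper_colorings V E n))"
    using assms by blast
next
  fix q assume q: "\<forall>n::nat. poly q (int n) = int (card (proper_colorings V E n))"
  have "range int \<subseteq> {x. poly (q - p) x = 0}"
    using q assms by auto
  moreover have "infinite (range int)"
    by (simp add: finite_image_iff)
  ultimately have "infinite {x. poly (q - p) x = 0}"
    using finite_subset by blast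
  then have "q - p = 0"
    using poly_roots_finite by blast
  then show "q = p" by simp
qed

definition D_permutation_on :: "nat set \<Rightarrow> (nat \<Rightarrow> nat) \<Rightarrow> bool" where
  "D_permutation_on A \<sigma> \<longleftrightarrow>
     \<sigma> permutes A \<and> (\<forall>i\<in>A. odd i \<longrightarrow> i \<le> \<sigma> i) \<and> (\<forall>i\<in>A. even i \<longrightarrow> i \<ge> \<sigma> i)"

text \<open>The cycles of a permutation of a finite set \<open>A\<close> correspond to its orbits on \<open>A\<close>; the orbit
  of a fixed point \<open>i\<close> is \<open>{i}\<close>, so fixed points in \<open>A\<close> count as cycles, while points
  outside \<open>A\<close> do not contribute.\<close>

definition num_cycles_on :: "'a set \<Rightarrow> ('a \<Rightarrow> 'a) \<Rightarrow> nat" where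
  "num_cycles_on A \<sigma> = card (orbit \<sigma> ` A)"

text \<open>The sign is chosen so that \<open>(-1) ^ (card A - k) * s\<^sub>D A k\<close> is the number of D-permutations
  on \<open>A\<close> with exactly \<open>k\<close> cycles. When \<open>card A\<close> is even this is the same as
  \<open>(-1) ^ k * s\<^sub>D A k\<close>; when \<open>card A\<close> is odd the latter normalisation is off by a global sign
  (a one-vertex graph has chromatic polynomial \<open>t\<close>, not \<open>-t\<close>). The subtraction is only
  relevant for \<open>k \<le> card A\<close>: for larger \<open>k\<close> there are no such permutations.\<close>

definition s\<^sub>D :: "nat set \<Rightarrow> nat \<Rightarrow> int" where
  "s\<^sub>D A k =
     (-1) ^ (card A - k) * int (card {\<sigma>. D_permutation_on A \<sigma> \<and> num_cycles_on A \<sigma> = k})"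

lemma s\<^sub>D_normalisation:
  "(-1) ^ (card A - k) * s\<^sub>D A k = int (card {\<sigma>. D_permutation_on A \<sigma> \<and> num_cycles_on A \<sigma> = k})"
  by (simp add: s\<^sub>D_def flip: mult.assoc power_add mult_2)

end

theory Submission
  imports Defs
begin

text \<open>
  The number of maps from \<open>A\<close> to \<open>n\<close> colours that are constant on the cycles of a permutation
  \<open>\<sigma>\<close> is \<open>n\<close> to the number of cycles of \<open>\<sigma>\<close>, and the sign attached to \<open>\<sigma>\<close> in the statement is
  its signature. Exchanging sums, the right-hand side evaluated at \<open>n\<close> is therefore the sum, over
  all maps \<open>c\<close>, of the signatures of the D-permutations preserving \<open>c\<close>. If \<open>c\<close> is a proper
  colouring, only the identity preserves \<open>c\<close>. Otherwise some colour class contains an odd \<open>u\<close> and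
  an even \<open>v > u\<close> that are consecutive within the class; composing with the transposition of \<open>u\<close>
  and \<open>v\<close> is then a sign-reversing involution, so the contribution of \<open>c\<close> vanishes.
\<close>

section \<open>Cycles and the signature\<close>

lemma orbit_eq_iff_mem:
  assumes "permutation p"
  shows "orbit p x = orbit p y \<longleftrightarrow> x \<in> orbit p y"
proof
  have self: "z \<in> orbit p z" for z
    by (rule permutation_self_in_orbit[OF assms])
  show "x \<in> orbit p y" if "orbit p x = orbit p y"
    using self[of x] that by simp
  assume x: "x \<in> orbit p y"
  then have "y \<in> orbit p x"
    by (rule orbit_swap[OF self])
  with x show "orbit p x = orbit p y"
    by (blast intro: orbit_trans)
qed

text \<open>Composing with \<open>transpose a (p a)\<close> cuts \<open>a\<close> out of its cycle:
  the predecessor of \<open>a\<close> is sent straight to \<open>p a\<close>, \<open>a\<close>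
  becomes fixed, and all other values stay the same.\<close>

lemma orbit_delete_point:
  assumes p: "p permutes insert a F" and "finite F" "a \<notin> F" "x \<in> F"
  shows "orbit (transpose a (p a) \<circ> p) x = orbit p x - {a}"
proof -
  define q where "q = transpose a (p a) \<circ> p"
  have q: "q permutes F"
    unfolding q_def by (rule permutes_insert_lemma[OF p])
  have q_eq: "q y = (if p y = a then p a else p y)" if "y \<noteq> a" for y
    using that permutes_inj[OF p] by (auto simp: q_def transpose_def dest: injD)
  have "orbit q x \<subseteq> F"
    using permutes_orbit_subset[OF q \<open>x \<in> F\<close>] .
  moreover have "y \<in> orbit p x" if "y \<in> orbit q x" for y
    using that
  proof induction
    case base
    have "x \<noteq> a" using assms by blast
    then show ?case
      using q_eq[of x] orbit.base[of p x] orbit.step[of "p x" p x] by (auto split: if_splits)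
  next
    case (step y)
    then have "y \<noteq> a"
      using \<open>orbit q x \<subseteq> F\<close> assms by blast
    then show ?case
      using q_eq[of y] orbit.step[OF step.IH] orbit.step[of "p y" p x] by (auto split: if_splits)
  qed
  \<comment> \<open>The new orbit skips \<open>a\<close>, so for the induction to go through
    \<open>a\<close> is replaced by \<open>p a\<close>, the point where the two orbits meet
    again.\<close>
  moreover have "(if y = a then p a else y) \<in> orbit q x" if "y \<in> orbit p x" for y
    using that
  proof induction
    case base
    have "x \<noteq> a" using assms by blast
    then show ?case
      using q_eq[of x] orbit.base[of q x] by auto
  next
    case (step y)
    then show ?case
      using q_eq[of y] orbit.step[of y q x] by (auto split: if_splits)
  qed
  ultimately show ?thesis
    using assms(3) unfolding q_def[symmetric] by (fastforce split: if_splits)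
qed

text \<open>Points are removed one at a time. A fixed point contributes 1 to both the cardinality
  and the number of cycles, so the parity is unchanged. Cutting any other point out of its cycle
  flips the signature and keeps the number of cycles, while the cardinality drops by 1.\<close>

lemma sign_eq_num_cycles:
  assumes "finite A" "p permutes A"
  shows "sign p = (-1) ^ (card A + num_cycles_on A p)"
  using assms
proof (induction A arbitrary: p rule: finite_induct)
  case empty
  then show ?case by (simp add: num_cycles_on_def)
next
  case (insert a F p)
  define q where "q = transpose a (p a) \<circ> p"
  have perm: "permutation p"
    using insert.prems insert.hyps by (meson finite_insert permutes_imp_permutation)
  have q: "q permutes F"
    unfolding q_def by (rule permutes_insert_lemma[OF insert.prems])
  have IH: "sign q = (-1) ^ (card F + num_cycles_on F q)"
    by (rule insert.IH[OF q])
  show ?case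
  proof (cases "p a = a")
    case True
    then have qp: "q = p" by (simp add: q_def)
    have "orbit p a = {a}"
      using True by (simp add: orbit_eq_singleton_iff)
    moreover have "orbit p x \<subseteq> F" if "x \<in> F" for x
      using permutes_orbit_subset q qp that by metis
    ultimately have "orbit p a \<notin> orbit p ` F"
      using insert.hyps by blast
    then have "num_cycles_on (insert a F) p = Suc (num_cycles_on F p)"
      using insert.hyps by (simp add: num_cycles_on_def)
    then show ?thesis
      using IH insert.hyps by (simp add: qp)
  next
    case False
    then have pa: "p a \<in> F"
      using permutes_in_image[OF insert.prems, of a] by auto
    have "orbit p a = orbit p (p a)"
      by (rule permutation_orbit_step[OF perm, symmetric])
    then have "orbit p ` insert a F = orbit p ` F"
      using pa by auto
    moreover have "orbit q ` F = (\<lambda>S. S - {a}) ` orbit p ` F"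
      unfolding image_image q_def
      using orbit_delete_point[OF insert.prems insert.hyps] by (intro image_cong) auto
    \<comment> \<open>Each of these orbits contains a point of \<open>F\<close>, which survives the
      removal of \<open>a\<close>; orbits that agree after the removal therefore share a
      point.\<close>
    moreover have "inj_on (\<lambda>S. S - {a}) (orbit p ` F)"
    proof (rule inj_onI, clarify)
      fix x y assume "x \<in> F" "y \<in> F" and eq: "orbit p x - {a} = orbit p y - {a}"
      then have "x \<in> orbit p y"
        using permutation_self_in_orbit[OF perm, of x] insert.hyps by blast
      then show "orbit p x = orbit p y"
        by (simp add: orbit_eq_iff_mem[OF perm])
    qed
    ultimately have cyc: "num_cycles_on (insert a F) p = num_cycles_on F q"
      by (simp add: num_cycles_on_def card_image)
    have "sign q = - sign p"
      unfolding q_def using False perm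
      by (simp add: sign_compose permutation_swap_id sign_swap_id)
    then show ?thesis
      using IH insert.hyps by (simp add: cyc)
  qed
qed

section \<open>Colourings constant on cycles\<close>

text \<open>An invariant colouring factors uniquely through \<open>orbit p\<close>, so it amounts to
  a free choice of one colour per cycle.\<close>

lemma card_invariant_colorings:
  assumes "finite A" "p permutes A"
  shows "card {c \<in> A \<rightarrow>\<^sub>E {..<n}. \<forall>i\<in>A. c (p i) = c i} = n ^ num_cycles_on A p"
proof -
  let ?C = "{c \<in> A \<rightarrow>\<^sub>E {..<n}. \<forall>i\<in>A. c (p i) = c i}"
  have perm: "permutation p"
    using assms by (metis permutes_imp_permutation)
  have self: "x \<in> orbit p x" for x
    by (rule permutation_self_in_orbit[OF perm])
  have const: "c y = c x" if "c \<in> ?C" "x \<in> A" "y \<in> orbit p x" for c x y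
  proof -
    have "y \<in> A \<and> c y = c x"
      using that(3) by induction (use that assms in \<open>auto simp: permutes_in_image\<close>)
    then show ?thesis ..
  qed
  have "bij_betw (\<lambda>g. restrict (g \<circ> orbit p) A) (orbit p ` A \<rightarrow>\<^sub>E {..<n}) ?C"
    unfolding bij_betw_def
  proof
    show "inj_on (\<lambda>g. restrict (g \<circ> orbit p) A) (orbit p ` A \<rightarrow>\<^sub>E {..<n})"
    proof (rule inj_onI)
      fix g h
      assume g: "g \<in> orbit p ` A \<rightarrow>\<^sub>E {..<n}" and h: "h \<in> orbit p ` A \<rightarrow>\<^sub>E {..<n}"
        and eq: "restrict (g \<circ> orbit p) A = restrict (h \<circ> orbit p) A"
      show "g = h"
      proof (rule PiE_ext[OF g h])
        fix S assume "S \<in> orbit p ` A"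
        then obtain x where "x \<in> A" "S = orbit p x" by blast
        then show "g S = h S"
          using fun_cong[OF eq, of x] by simp
      qed
    qed
    show "(\<lambda>g. restrict (g \<circ> orbit p) A) ` (orbit p ` A \<rightarrow>\<^sub>E {..<n}) = ?C" (is "?I = _")
    proof
      show "?I \<subseteq> ?C"
        using assms by (auto simp: permutes_in_image permutation_orbit_step[OF perm])
      show "?C \<subseteq> ?I"
      proof
        fix c assume c: "c \<in> ?C"
        \<comment> \<open>The choice of representative does not matter, since \<open>c\<close> is
          constant on each orbit by \<open>const\<close>.\<close>
        define g where "g = restrict (\<lambda>S. c (SOME x. x \<in> S)) (orbit p ` A)"
        have g: "g (orbit p x) = c x" if "x \<in> A" for x
          using const[OF c that] someI[of "\<lambda>y. y \<in> orbit p x", OF self] that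
          by (simp add: g_def)
        have "g \<in> orbit p ` A \<rightarrow>\<^sub>E {..<n}"
        proof (rule PiE_I)
          fix S assume "S \<in> orbit p ` A"
          then show "g S \<in> {..<n}" using g c by (force simp: PiE_iff)
        qed (simp add: g_def)
        moreover have "c = restrict (g \<circ> orbit p) A"
          using c by (intro ext) (auto simp: g restrict_def PiE_iff extensional_def)
        ultimately show "c \<in> ?I" by blast
      qed
    qed
  qed
  from bij_betw_same_card[OF this] show ?thesis
    using assms by (simp add: card_PiE num_cycles_on_def)
qed

section \<open>D-permutations preserving a colouring\<close>

lemma finite_D_permutations: "finite A \<Longrightarrow> finite {\<sigma>. D_permutation_on A \<sigma>}"
  by (rule finite_subset[OF _ finite_permutations[of A]]) (auto simp: D_permutation_on_def)

text \<open>An odd point sent to an even one would move strictly up along an edge with equal colours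
  at its ends. Hence the odd points are permuted among themselves, and as none moves down, all are
  fixed. Then no point of \<open>A\<close> moves up, which leaves only the identity.\<close>

lemma D_permutation_preserving_proper_coloring:
  assumes "c \<in> proper_colorings A (Gamma_edges A) n"
    and \<sigma>: "D_permutation_on A \<sigma>" and inv: "\<forall>i\<in>A. c (\<sigma> i) = c i"
    and "finite A"
  shows "\<sigma> = id"
proof -
  have perm: "\<sigma> permutes A"
    using \<sigma> by (simp add: D_permutation_on_def)
  let ?O = "{i \<in> A. odd i}"
  have odd_odd: "\<sigma> i \<in> ?O" if "i \<in> ?O" for i
  proof (rule ccontr)
    assume "\<sigma> i \<notin> ?O"
    moreover have "\<sigma> i \<in> A" "i \<le> \<sigma> i"
      using that \<sigma> perm by (auto simp: D_permutation_on_def permutes_in_image)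
    ultimately have "even (\<sigma> i)" "i < \<sigma> i" "\<sigma> i \<in> A"
      using that by (auto simp: le_less)
    then have "{i, \<sigma> i} \<in> Gamma_edges A"
      using that unfolding Gamma_edges_def by blast
    then have "c i \<noteq> c (\<sigma> i)"
      using assms(1) by (auto simp: proper_colorings_def)
    then show False using inv that by auto
  qed
  \<comment> \<open>Outside the odd points \<tau> is the identity, so that it is a permutation of
    \<open>?O\<close> in the sense of \<open>permutes\<close>.\<close>
  define \<tau> where "\<tau> i = (if i \<in> ?O then \<sigma> i else i)" for i
  have fixed: "\<sigma> i = i" if "i \<in> A" "odd i" for i
  proof -
    have inj: "inj_on \<sigma> ?O"
      by (rule permutes_inj_on[OF perm])
    have "finite ?O"
      using \<open>finite A\<close> by simp
    moreover have "\<sigma> ` ?O \<subseteq> ?O"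
      using odd_odd by (rule image_subsetI)
    ultimately have "\<sigma> ` ?O = ?O"
      using inj by (rule endo_inj_surj)
    with inj have "bij_betw \<sigma> ?O ?O"
      unfolding bij_betw_def ..
    then have "bij_betw \<tau> ?O ?O"
      by (rule iffD1[OF bij_betw_cong, rotated]) (auto simp: \<tau>_def)
    then have "\<tau> permutes ?O"
      by (rule bij_imp_permutes) (auto simp: \<tau>_def)
    then have "\<tau> = id"
      by (rule permutes_natset_ge) (use \<sigma> in \<open>auto simp: \<tau>_def D_permutation_on_def\<close>)
    then have "\<tau> i = i" by simp
    then show ?thesis using that by (simp add: \<tau>_def)
  qed
  show ?thesis
  proof (rule permutes_natset_le[OF perm], rule ballI)
    fix i assume "i \<in> A"
    then show "\<sigma> i \<le> i"
      using fixed[of i] \<sigma> by (cases "odd i") (auto simp: D_permutation_on_def)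
  qed
qed

text \<open>Left composition with the transposition is an involution of \<open>S\<close> that flips
  signatures, so the sum equals its own negative.\<close>

lemma sum_sign_closed_under_transpose:
  assumes "u \<noteq> v" and perm: "\<And>\<sigma>. \<sigma> \<in> S \<Longrightarrow> permutation \<sigma>"
    and closed: "\<And>\<sigma>. \<sigma> \<in> S \<Longrightarrow> transpose u v \<circ> \<sigma> \<in> S"
  shows "(\<Sum>\<sigma>\<in>S. sign \<sigma>) = 0"
proof -
  have "(\<Sum>\<sigma>\<in>S. sign \<sigma>) = (\<Sum>\<sigma>\<in>S. - sign \<sigma>)"
    by (rule sum.reindex_bij_witness[of _ "(\<circ>) (transpose u v)" "(\<circ>) (transpose u v)"])
      (use assms in \<open>auto simp: o_assoc sign_compose permutation_swap_id sign_swap_id\<close>)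
  then show ?thesis by (simp add: sum_negf)
qed

lemma sum_sign_improper_coloring:
  assumes c: "c \<in> A \<rightarrow>\<^sub>E {..<n}" "c \<notin> proper_colorings A (Gamma_edges A) n"
    and "finite A"
  shows "(\<Sum>\<sigma> | D_permutation_on A \<sigma> \<and> (\<forall>i\<in>A. c (\<sigma> i) = c i). sign \<sigma>) = 0"
proof -
  define P where "P = (\<lambda>(u, v). u \<in> A \<and> v \<in> A \<and> u < v \<and> odd u \<and> even v \<and> c u = c v)"
  have "\<exists>e. P e"
    using c by (fastforce simp: P_def proper_colorings_def Gamma_edges_def doubleton_eq_iff)
  \<comment> \<open>A monochromatic edge of least length is chosen. A point \<open>w\<close> of the
    same colour strictly between its ends would give a shorter one: \<open>(u, w)\<close> if
    \<open>w\<close> is even, \<open>(w, v)\<close> if \<open>w\<close> is odd.\<close>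
  then obtain e where e: "P e" "\<And>e'. P e' \<Longrightarrow> snd e - fst e \<le> snd e' - fst e'"
    using ex_has_least_nat[of P _ "\<lambda>e. snd e - fst e"] by blast
  obtain u v where uv: "e = (u, v)" by force
  have P: "u \<in> A" "v \<in> A" "u < v" "odd u" "even v" "c u = c v"
    using e(1) by (auto simp: uv P_def)
  have gap: "w \<le> u \<or> v \<le> w" if w: "w \<in> A" "c w = c u" for w
  proof (rule ccontr)
    assume "\<not> (w \<le> u \<or> v \<le> w)"
    moreover have "P (u, w) \<or> P (w, v)"
      using calculation P w by (auto simp: P_def)
    ultimately show False
      using e(2)[of "(u, w)"] e(2)[of "(w, v)"] uv by auto
  qed
  let ?t = "transpose u v"
  show ?thesis
  proof (rule sum_sign_closed_under_transpose[of u v])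
    fix \<sigma> assume "\<sigma> \<in> {\<sigma>. D_permutation_on A \<sigma> \<and> (\<forall>i\<in>A. c (\<sigma> i) = c i)}"
    then have \<sigma>: "\<sigma> permutes A" "\<And>i. i \<in> A \<Longrightarrow> odd i \<Longrightarrow> i \<le> \<sigma> i"
      "\<And>i. i \<in> A \<Longrightarrow> even i \<Longrightarrow> \<sigma> i \<le> i" "\<And>i. i \<in> A \<Longrightarrow> c (\<sigma> i) = c i"
      by (auto simp: D_permutation_on_def)
    show "permutation \<sigma>"
      using \<sigma>(1) \<open>finite A\<close> by (metis permutes_imp_permutation)
    have "?t \<circ> \<sigma> permutes A"
      using \<sigma>(1) P by (simp add: permutes_compose permutes_swap_id)
    moreover have "c ((?t \<circ> \<sigma>) i) = c i" if "i \<in> A" for i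
      using \<sigma>(4)[OF that] P by (auto simp: transpose_def)
    moreover have "i \<le> (?t \<circ> \<sigma>) i" if "i \<in> A" "odd i" for i
    proof -
      \<comment> \<open>The only value that is lowered is \<open>v\<close>, which becomes
        \<open>u\<close>. Here \<open>i\<close> is odd, so \<open>i < v\<close>, and it has the
        colour of \<open>u\<close>; by \<open>gap\<close> it cannot lie above
        \<open>u\<close>.\<close>
      have "\<sigma> i = v \<Longrightarrow> i \<le> u"
        using gap[of i] \<sigma>(2,4)[of i] that P by force
      then show ?thesis
        using \<sigma>(2)[OF that] P by (auto simp: transpose_def)
    qed
    moreover have "(?t \<circ> \<sigma>) i \<le> i" if "i \<in> A" "even i" for i
    proof -
      \<comment> \<open>Dually, the only value that is raised is \<open>u\<close>, and an even
        \<open>i\<close> above \<open>u\<close> of the same colour is at least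
        \<open>v\<close>.\<close>
      have "\<sigma> i = u \<Longrightarrow> v \<le> i"
        using gap[of i] \<sigma>(3,4)[of i] that P by force
      then show ?thesis
        using \<sigma>(3)[OF that] P by (auto simp: transpose_def)
    qed
    ultimately show "?t \<circ> \<sigma> \<in> {\<sigma>. D_permutation_on A \<sigma> \<and> (\<forall>i\<in>A. c (\<sigma> i) = c i)}"
      by (simp add: D_permutation_on_def)
  qed (use P in auto)
qed

section \<open>Evaluation of the chromatic polynomial\<close>

lemma card_proper_colorings_Gamma:
  assumes "finite A"
  shows "int (card (proper_colorings A (Gamma_edges A) n)) =
    (\<Sum>\<sigma> | D_permutation_on A \<sigma>. sign \<sigma> * int n ^ num_cycles_on A \<sigma>)"
proof -
  let ?D = "{\<sigma>. D_permutation_on A \<sigma>}" and ?C = "A \<rightarrow>\<^sub>E {..<n}"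
    and ?P = "proper_colorings A (Gamma_edges A) n"
  let ?I = "\<lambda>\<sigma> c. \<forall>i\<in>A. c (\<sigma> i) = c i"
  have fin: "finite ?C" "finite ?D"
    using assms by (auto intro: finite_PiE finite_D_permutations)
  have "(\<Sum>\<sigma>\<in>?D. sign \<sigma> * int n ^ num_cycles_on A \<sigma>)
      = (\<Sum>\<sigma>\<in>?D. \<Sum>c | c \<in> ?C \<and> ?I \<sigma> c. sign \<sigma>)"
  proof (rule sum.cong)
    fix \<sigma> assume "\<sigma> \<in> ?D"
    then have "card {c \<in> ?C. ?I \<sigma> c} = n ^ num_cycles_on A \<sigma>"
      using assms by (intro card_invariant_colorings) (auto simp: D_permutation_on_def)
    then show "sign \<sigma> * int n ^ num_cycles_on A \<sigma> = (\<Sum>c | c \<in> ?C \<and> ?I \<sigma> c. sign \<sigma>)"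
      by simp
  qed simp
  also have "\<dots> = (\<Sum>c\<in>?C. \<Sum>\<sigma> | \<sigma> \<in> ?D \<and> ?I \<sigma> c. sign \<sigma>)"
    by (rule sum.swap_restrict[OF fin(2,1)])
  \<comment> \<open>For fixed \<open>c\<close> the signed sum is the indicator of properness: either
    the identity alone remains, with sign 1, or everything cancels.\<close>
  also have "\<dots> = (\<Sum>c\<in>?C. if c \<in> ?P then 1 else 0)"
  proof (rule sum.cong)
    fix c assume c: "c \<in> ?C"
    show "(\<Sum>\<sigma> | \<sigma> \<in> ?D \<and> ?I \<sigma> c. sign \<sigma>) = (if c \<in> ?P then 1 else 0)"
    proof (cases "c \<in> ?P")
      case True
      then have "{\<sigma>. \<sigma> \<in> ?D \<and> ?I \<sigma> c} = {id}"
        using D_permutation_preserving_proper_coloring[OF True _ _ assms]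
        by (auto simp: D_permutation_on_def permutes_id)
      then show ?thesis using True by simp
    next
      case False
      then show ?thesis
        using sum_sign_improper_coloring[OF c False assms] by simp
    qed
  qed simp
  also have "\<dots> = int (card (?C \<inter> ?P))"
    using fin by (simp add: sum.If_cases)
  also have "?C \<inter> ?P = ?P"
    by (auto simp: proper_colorings_def)
  finally show ?thesis by simp
qed

text \<open>Needed to group the D-permutations by their number of cycles over the index range of the
  theorem.\<close>

lemma num_cycles_on_bounds:
  assumes "finite A" "A \<noteq> {}"
  shows "num_cycles_on A \<sigma> \<in> {1..card A}"
  using assms card_image_le[OF assms(1), of "orbit \<sigma>"]
  by (auto simp: num_cycles_on_def Suc_le_eq card_gt_0_iff)

text \<open>The empty set is excluded because it has exactly one colouring, hence chromatic
  polynomial 1, whereas the sum from 1 to 0 vanishes.\<close>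

theorem corollary4p10:
  fixes A :: "nat set"
  assumes "finite A" and "A \<noteq> {}" and "A \<subseteq> {0<..}"
  shows "chromatic_polynomial A (Gamma_edges A) = (\<Sum>k = 1..card A. monom (s\<^sub>D A k) k)"
proof (rule chromatic_polynomial_eqI)
  fix n :: nat
  let ?D = "{\<sigma>. D_permutation_on A \<sigma>}"
  have "int (card (proper_colorings A (Gamma_edges A) n)) =
      (\<Sum>\<sigma>\<in>?D. sign \<sigma> * int n ^ num_cycles_on A \<sigma>)"
    by (rule card_proper_colorings_Gamma[OF assms(1)])
  also have "\<dots> = (\<Sum>k = 1..card A. \<Sum>\<sigma> | \<sigma> \<in> ?D \<and> num_cycles_on A \<sigma> = k.
      sign \<sigma> * int n ^ num_cycles_on A \<sigma>)"
    using num_cycles_on_bounds[OF assms(1,2)]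
    by (intro sum.group[symmetric] finite_D_permutations assms) auto
  also have "\<dots> = (\<Sum>k = 1..card A. s\<^sub>D A k * int n ^ k)"
  proof (rule sum.cong)
    fix k assume "k \<in> {1..card A}"
    \<comment> \<open>Since \<open>k\<close> is at most \<open>card A\<close>, the subtraction does
      not truncate; the signature thus agrees with the sign built into
      \<open>s\<^sub>D\<close>.\<close>
    then have "even (card A - k) \<longleftrightarrow> even (card A + k)"
      by simp
    then have "(\<Sum>\<sigma> | \<sigma> \<in> ?D \<and> num_cycles_on A \<sigma> = k. sign \<sigma> * int n ^ num_cycles_on A \<sigma>) =
        (\<Sum>\<sigma> | \<sigma> \<in> ?D \<and> num_cycles_on A \<sigma> = k. (-1) ^ (card A - k) * int n ^ k)"
      using assms(1)
      by (intro sum.cong refl)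
        (auto simp: sign_eq_num_cycles D_permutation_on_def minus_one_power_iff)
    then show "(\<Sum>\<sigma> | \<sigma> \<in> ?D \<and> num_cycles_on A \<sigma> = k. sign \<sigma> * int n ^ num_cycles_on A \<sigma>) =
        s\<^sub>D A k * int n ^ k"
      by (simp add: s\<^sub>D_def mult_ac)
  qed simp
  also have "\<dots> = poly (\<Sum>k = 1..card A. monom (s\<^sub>D A k) k) (int n)"
    by (simp add: poly_sum poly_monom)
  finally show "poly (\<Sum>k = 1..card A. monom (s\<^sub>D A k) k) (int n) =
      int (card (proper_colorings A (Gamma_edges A) n))" ..
qed

end
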